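(* Let $x\in(-1,1)$, $\mu\in\mathbb C$, $n\in\mathbb N_0$. Then $${\sf P}_{n+\mu}^{-\mu}(x)=\frac{(-1)^n}{2^{\mu+n}\,\Gamma(\mu+n+1)\,(1-x^2)^{\frac{\mu}{2}}}\left(\frac{\mathrm d}{\mathrm dx}\right)^n\left[(1-x^2)^{\mu+n}\right].$$
   Context: $\mathbb N_0=\{0,1,2,\ldots\}$. The Ferrers function of the first kind is, for $\nu,\mu\in\mathbb C$ and $x\in(-1,1)$, $${\sf P}_\nu^{-\mu}(x)=\frac{1}{\Gamma(\mu+1)}\left(\frac{1-x}{1+x}\right)^{\frac{\mu}{2}}{}_2F_1\left(-\nu,\nu+1;\mu+1;\frac{1-x}{2}\right)=\left(\frac{1-x}{1+x}\right)^{\frac{\mu}{2}}\sum_{k=0}^\infty\frac{(-\nu)_k(\nu+1)_k}{\Gamma(\mu+1+k)\,k!}\left(\frac{1-x}{2}\right)^k,$$ where $(a)_0=1$, $(a)_k=a(a+1)\cdots(a+k-1)$, and $1/\Gamma$ denotes the entire reciprocal gamma function (equal to $0$ at the poles of $\Gamma$). Powers of positive reals are principal. *)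

theory Defs
  imports "HOL-Analysis.Analysis"
begin

text \<open>
  Regularized (Olver) Gauss series, i.e. \<open>\<^sub>2F\<^sub>1(a, b; c; z) / \<Gamma>(c)\<close>. With \<open>rGamma\<close> (the entire
  reciprocal Gamma function) it also makes sense for \<open>c \<in> {0, -1, -2, \<dots>}\<close>. The value is meaningful
  only where the series converges, in particular for \<open>|z| < 1\<close>.
\<close>

definition hyp2f1_reg :: "complex \<Rightarrow> complex \<Rightarrow> complex \<Rightarrow> complex \<Rightarrow> complex" where
  "hyp2f1_reg a b c z =
     (\<Sum>k. pochhammer a k * pochhammer b k * rGamma (c + of_nat k) / fact k * z ^ k)"

text \<open>
  \<open>ferrersP \<nu> \<kappa> x\<close> is the Ferrers function of the first kind of degree \<open>\<nu>\<close> and order \<open>\<kappa>\<close>, for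
  \<open>-1 < x < 1\<close>. The order is the superscript itself, so the literature's formula with superscript
  \<open>-\<mu>\<close> is the case \<open>\<kappa> = -\<mu>\<close>.
\<close>

definition ferrersP :: "complex \<Rightarrow> complex \<Rightarrow> real \<Rightarrow> complex" where
  "ferrersP \<nu> \<kappa> x =
     of_real ((1 - x) / (1 + x)) powr (- \<kappa> / 2) *
     hyp2f1_reg (- \<nu>) (\<nu> + 1) (1 - \<kappa>) (of_real ((1 - x) / 2))"

text \<open>
  Iterated derivative of a function of a real variable. (The library's iterated \<open>deriv\<close> does not
  apply to functions from the reals to the complex numbers.)
\<close>

definition nth_vector_derivative :: "nat \<Rightarrow> (real \<Rightarrow> 'a::real_normed_vector) \<Rightarrow> real \<Rightarrow> 'a" where
  "nth_vector_derivative n f = ((\<lambda>g t. vector_derivative g (at t)) ^^ n) f"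

end

theory Submission
  imports Defs
begin

text \<open>
  Put \<open>a = \<mu> + n\<close> and \<open>s = (1 - t) / 2\<close>, so that \<open>1 - t\<^sup>2 = 4 s (1 - s)\<close>. The binomial series
  gives \<open>(1 - t\<^sup>2)\<^sup>a = 4\<^sup>a s\<^sup>a (\<Sum>k. (- a)\<^sub>k / k! s\<^sup>k)\<close> for \<open>-1 < t < 1\<close>. Differentiating
  \<open>n\<close> times with respect to \<open>t\<close>, term by term, multiplies the \<open>k\<close>-th coefficient by
  \<open>(\<mu> + k + 1)\<^sub>n\<close>, lowers the exponent \<open>a\<close> to \<open>\<mu>\<close> and produces the factor \<open>(- 1 / 2)\<^sup>n\<close>
  (lemma \<open>nth_vector_derivative_powr_times_powser\<close>). Both
  \<open>(\<mu> + k + 1)\<^sub>n / \<Gamma>(a + 1)\<close> and \<open>(a + 1)\<^sub>k / \<Gamma>(\<mu> + k + 1)\<close> are equal to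
  \<open>(\<mu> + k + 1)\<^sub>n (a + 1)\<^sub>k / \<Gamma>(a + k + 1)\<close>, so the resulting series is the regularized Gauss
  series with parameters \<open>- a\<close>, \<open>a + 1\<close>, \<open>\<mu> + 1\<close>. This identity holds for the entire function
  \<open>1 / \<Gamma>\<close> without exception, hence exceptional values of \<open>\<mu>\<close> need no separate treatment. What
  remains is to compare powers of the positive reals \<open>2\<close>, \<open>s\<close> and \<open>1 - s\<close>.
\<close>

lemma summable_linear_times_powser:
  fixes c :: "nat \<Rightarrow> 'a::{real_normed_field,banach}"
  assumes conv: "\<And>z. norm z < 1 \<Longrightarrow> summable (\<lambda>k. c k * z ^ k)"
    and z: "norm z < 1"
  shows "summable (\<lambda>k. (a + of_nat k) * c k * z ^ k)"
proof -
  have "summable (\<lambda>k. diffs c k * z ^ k)"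
    using termdiff_converges[OF z conv] .
  then have "summable (\<lambda>k. z * (diffs c k * z ^ k))"
    by (rule summable_mult)
  then have "summable (\<lambda>k. of_nat (Suc k) * c (Suc k) * z ^ Suc k)"
    by (simp add: diffs_def mult_ac)
  then have "summable (\<lambda>k. of_nat k * c k * z ^ k)"
    by (subst (asm) summable_Suc_iff)
  from summable_add[OF summable_mult[OF conv[OF z], of a] this] show ?thesis
    by (simp add: algebra_simps)
qed

lemma has_field_derivative_powr_times_powser:
  fixes c :: "nat \<Rightarrow> complex"
  assumes conv: "\<And>z. norm z < 1 \<Longrightarrow> summable (\<lambda>k. c k * z ^ k)"
    and z: "norm z < 1" "z \<notin> \<real>\<^sub>\<le>\<^sub>0"
  shows "((\<lambda>z. z powr a * (\<Sum>k. c k * z ^ k)) has_field_derivative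
           z powr (a - 1) * (\<Sum>k. (a + of_nat k) * c k * z ^ k)) (at z)"
proof -
  have z0: "z \<noteq> 0"
    using z(2) by auto
  have sum0: "summable (\<lambda>k. of_nat k * c k * z ^ k)"
    using summable_linear_times_powser[OF conv z(1), of 0] by simp
  \<comment> \<open>The Euler operator \<open>z d/dz\<close> multiplies the coefficient of \<open>z\<^sup>k\<close> by \<open>k\<close>.\<close>
  have "(\<Sum>k. of_nat k * c k * z ^ k) = (\<Sum>k. of_nat (Suc k) * c (Suc k) * z ^ Suc k)"
    using suminf_split_head[OF sum0] by simp
  also have "\<dots> = (\<Sum>k. z * (diffs c k * z ^ k))"
    by (simp add: diffs_def mult_ac)
  also have "\<dots> = z * (\<Sum>k. diffs c k * z ^ k)"
    by (intro suminf_mult termdiff_converges[OF z(1) conv])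
  finally have euler: "(\<Sum>k. of_nat k * c k * z ^ k) = z * (\<Sum>k. diffs c k * z ^ k)" .
  have "(\<Sum>k. (a + of_nat k) * c k * z ^ k)
          = (\<Sum>k. a * (c k * z ^ k) + of_nat k * c k * z ^ k)"
    by (simp add: algebra_simps)
  also have "\<dots> = a * (\<Sum>k. c k * z ^ k) + z * (\<Sum>k. diffs c k * z ^ k)"
    using suminf_add[OF summable_mult[OF conv[OF z(1)], of a] sum0]
      suminf_mult[OF conv[OF z(1)], of a] euler by simp
  finally have split: "(\<Sum>k. (a + of_nat k) * c k * z ^ k)
      = a * (\<Sum>k. c k * z ^ k) + z * (\<Sum>k. diffs c k * z ^ k)" .
  have pow: "z powr a = z powr (a - 1) * z"
    using z0 by (simp add: powr_diff)
  have "((\<lambda>z. z powr a * (\<Sum>k. c k * z ^ k)) has_field_derivative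
           (a * z powr (a - 1)) * (\<Sum>k. c k * z ^ k) + (\<Sum>k. diffs c k * z ^ k) * z powr a) (at z)"
    by (intro DERIV_mult has_field_derivative_powr z(2) termdiffs_strong'[OF conv z(1)])
  then show ?thesis
    unfolding split by (simp add: pow algebra_simps)
qed

text \<open>
  The exponent \<open>a\<close> is an arbitrary complex number. The function \<open>f\<close> is prescribed only on the
  open interval, which suffices because iterated derivatives are local. After \<open>n\<close> steps the
  coefficient \<open>c k\<close> has been multiplied by
  \<open>(a + k) (a + k - 1) \<dots> (a + k - n + 1) = (a - n + k + 1)\<^sub>n\<close>.
\<close>

lemma nth_vector_derivative_powr_times_powser:
  fixes c :: "nat \<Rightarrow> complex" and f :: "real \<Rightarrow> complex"
  assumes conv: "\<And>z. norm z < 1 \<Longrightarrow> summable (\<lambda>k. c k * z ^ k)"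
    and f: "\<And>t. t \<in> {-1<..<1} \<Longrightarrow>
      f t = of_real ((1 - t) / 2) powr a * (\<Sum>k. c k * of_real ((1 - t) / 2) ^ k)"
    and x: "x \<in> {-1<..<1}"
  shows "nth_vector_derivative n f x = (- 1 / 2) ^ n *
      (of_real ((1 - x) / 2) powr (a - of_nat n) *
       (\<Sum>k. pochhammer (a - of_nat n + of_nat k + 1) n * c k * of_real ((1 - x) / 2) ^ k))"
    and "norm z < 1 \<Longrightarrow>
      summable (\<lambda>k. pochhammer (a - of_nat n + of_nat k + 1) n * c k * z ^ k)"
proof -
  define C where "C n k = pochhammer (a - of_nat n + of_nat k + 1) n * c k" for n k
  define G where "G n z = z powr (a - of_nat n) * (\<Sum>k. C n k * z ^ k)" for n z
  have C_Suc: "C (Suc n) k = (a - of_nat n + of_nat k) * C n k" for n k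
    by (simp add: C_def pochhammer_rec algebra_simps)
  have C_conv: "summable (\<lambda>k. C n k * z ^ k)" if "norm z < 1" for n z
    using that
  proof (induction n arbitrary: z)
    case 0
    then show ?case
      using conv by (simp add: C_def)
  next
    case (Suc n)
    show ?case
      unfolding C_Suc by (rule summable_linear_times_powser[OF Suc.IH Suc.prems])
  qed
  have G_deriv: "(G n has_field_derivative G (Suc n) z) (at z)"
    if "norm z < 1" "z \<notin> \<real>\<^sub>\<le>\<^sub>0" for n z
    using has_field_derivative_powr_times_powser[OF C_conv that, where a = "a - of_nat n"]
    by (simp add: G_def[abs_def] C_Suc algebra_simps)
  have "nth_vector_derivative n f t = (- 1 / 2) ^ n * G n (of_real ((1 - t) / 2))"
    if "t \<in> {-1<..<1}" for t
    using that
  proof (induction n arbitrary: t)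
    case 0
    then show ?case
      using f by (simp add: nth_vector_derivative_def G_def C_def)
  next
    case (Suc n)
    let ?s = "\<lambda>t. complex_of_real ((1 - t) / 2)"
    have s: "norm (?s t) < 1" "?s t \<notin> \<real>\<^sub>\<le>\<^sub>0"
      using Suc.prems unfolding norm_of_real by (auto simp: complex_nonpos_Reals_iff)
    have "(?s has_vector_derivative of_real (- 1 / 2)) (at t)"
      by (rule has_vector_derivative_of_real) (auto intro!: derivative_eq_intros)
    from field_vector_diff_chain_at[OF this G_deriv[OF s, of n]]
    have "((\<lambda>t. G n (?s t)) has_vector_derivative (- 1 / 2) * G (Suc n) (?s t)) (at t)"
      by (simp add: o_def)
    from has_vector_derivative_mult_right[OF this, of "(- 1 / 2) ^ n"]
    have "((\<lambda>t. (- 1 / 2) ^ n * G n (?s t)) has_vector_derivative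
        (- 1 / 2) ^ Suc n * G (Suc n) (?s t)) (at t)"
      by (simp add: mult_ac)
    then have "(nth_vector_derivative n f has_vector_derivative
        (- 1 / 2) ^ Suc n * G (Suc n) (?s t)) (at t)"
      by (rule has_vector_derivative_transform_within_open[where S = "{-1<..<1}"])
         (use Suc in auto)
    then show ?case
      by (simp add: nth_vector_derivative_def vector_derivative_at)
  qed
  from this[OF x] show "nth_vector_derivative n f x = (- 1 / 2) ^ n *
      (of_real ((1 - x) / 2) powr (a - of_nat n) *
       (\<Sum>k. pochhammer (a - of_nat n + of_nat k + 1) n * c k * of_real ((1 - x) / 2) ^ k))"
    by (simp add: G_def C_def)
  show "norm z < 1 \<Longrightarrow>
      summable (\<lambda>k. pochhammer (a - of_nat n + of_nat k + 1) n * c k * z ^ k)"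
    using C_conv[of z n] by (simp add: C_def)
qed

lemma powr_one_minus_sums:
  fixes z :: complex
  assumes "norm z < 1"
  shows "(\<lambda>k. pochhammer (- a) k / fact k * z ^ k) sums (1 - z) powr a"
proof -
  have "(\<lambda>k. (a gchoose k) * (- z) ^ k) sums (1 + - z) powr a"
    using assms by (intro gen_binomial_complex) simp
  moreover have "(a gchoose k) * (- z) ^ k = pochhammer (- a) k / fact k * z ^ k" for k
  proof -
    have "(- 1) ^ k * (- z) ^ k = z ^ k"
      by (simp flip: power_mult_distrib)
    then show ?thesis
      by (simp add: gbinomial_pochhammer mult_ac)
  qed
  ultimately show ?thesis
    by simp
qed

text \<open>
  Both sides equal \<open>(d)\<^sub>n (b)\<^sub>k / \<Gamma>(b + k)\<close>. Since the reciprocal Gamma function is entire, no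
  parameters have to be excluded.
\<close>

lemma pochhammer_rGamma_swap:
  fixes b d :: complex
  assumes "b + of_nat k = d + of_nat n"
  shows "pochhammer d n * rGamma b = pochhammer b k * rGamma d"
  using pochhammer_rGamma[of b k] pochhammer_rGamma[of d n] assms by simp

lemma powr_of_real_exp:
  fixes r :: real
  assumes "r > 0"
  shows "complex_of_real r powr w = exp (w * of_real (ln r))"
  using assms by (simp add: powr_def Ln_of_real)

lemma ln_one_minus_square:
  fixes t :: real
  assumes "t \<in> {-1<..<1}"
  shows "ln (1 - t\<^sup>2) = ln 4 + ln ((1 - t) / 2) + ln (1 - (1 - t) / 2)"
proof -
  have "1 - t\<^sup>2 = 4 * ((1 - t) / 2) * (1 - (1 - t) / 2)"
    by (simp add: field_simps power2_eq_square)
  also have "ln \<dots> = ln 4 + ln ((1 - t) / 2) + ln (1 - (1 - t) / 2)"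
    using assms by (subst ln_mult_pos ln_mult_pos, simp, simp)+ simp
  finally show ?thesis .
qed

theorem corollary1p9:
  fixes x :: real and \<mu> :: complex and n :: nat
  assumes "x \<in> {-1<..<1}"
  shows "ferrersP (of_nat n + \<mu>) (- \<mu>) x =
           (- 1) ^ n * rGamma (\<mu> + of_nat n + 1) /
             (2 powr (\<mu> + of_nat n) * of_real (1 - x\<^sup>2) powr (\<mu> / 2)) *
           nth_vector_derivative n (\<lambda>t. of_real (1 - t\<^sup>2) powr (\<mu> + of_nat n)) x"
proof -
  define a where "a = \<mu> + of_nat n"
  define c where "c k = 4 powr a * (pochhammer (- a) k / fact k)" for k
  define u where "u = (1 - x) / 2"
  define T where "T = (\<Sum>k. pochhammer (\<mu> + of_nat k + 1) n * c k * of_real u ^ k)"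
  define H where "H = hyp2f1_reg (- a) (a + 1) (1 + \<mu>) (of_real u)"
  have u: "0 < u" "u < 1"
    using assms by (auto simp: u_def)
  have c_sums: "(\<lambda>k. c k * z ^ k) sums (4 powr a * (1 - z) powr a)" if "norm z < 1" for z
    using sums_mult[OF powr_one_minus_sums[OF that, of a], of "4 powr a"]
    by (simp add: c_def mult_ac)
  have c_conv: "summable (\<lambda>k. c k * z ^ k)" if "norm z < 1" for z
    using c_sums[OF that] by (rule sums_summable)
  have f_eq: "of_real (1 - t\<^sup>2) powr a =
      of_real ((1 - t) / 2) powr a * (\<Sum>k. c k * of_real ((1 - t) / 2) ^ k)"
    if t: "t \<in> {-1<..<1}" for t
  proof -
    define v where "v = (1 - t) / 2"
    have v: "0 < v" "v < 1"
      using t by (auto simp: v_def)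
    have pos: "0 < 1 - t\<^sup>2"
      using t by (auto simp: abs_square_less_1)
    have "complex_of_real (1 - t\<^sup>2) powr a
        = of_real v powr a * (of_real 4 powr a * of_real (1 - v) powr a)"
      using v powr_of_real_exp[OF pos] powr_of_real_exp[of "1 - v" a]
      by (simp add: powr_of_real_exp ln_one_minus_square[OF t] v_def[symmetric] distrib_left
          exp_add mult_ac del: of_real_diff of_real_numeral)
    also have "of_real 4 powr a * of_real (1 - v) powr a = (\<Sum>k. c k * of_real v ^ k)"
      using sums_unique[OF c_sums[of "of_real v"]] v by simp
    finally show ?thesis
      by (simp only: v_def)
  qed
  have \<mu>: "a - of_nat n = \<mu>"
    by (simp add: a_def)
  have nth: "nth_vector_derivative n (\<lambda>t. of_real (1 - t\<^sup>2) powr a) x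
      = (- 1 / 2) ^ n * (of_real u powr \<mu> * T)"
    using nth_vector_derivative_powr_times_powser(1)[OF c_conv f_eq assms, of n]
    unfolding \<mu> u_def T_def .
  have T_conv: "summable (\<lambda>k. pochhammer (\<mu> + of_nat k + 1) n * c k * of_real u ^ k)"
    using nth_vector_derivative_powr_times_powser(2)[OF c_conv f_eq assms, of "of_real u" n] u
    by (simp add: \<mu>)
  have termwise: "rGamma (a + 1) * (pochhammer (\<mu> + of_nat k + 1) n * c k * of_real u ^ k)
      = 4 powr a * (pochhammer (- a) k * pochhammer (a + 1) k * rGamma (1 + \<mu> + of_nat k)
          / fact k * of_real u ^ k)" for k
  proof -
    have "pochhammer (\<mu> + of_nat k + 1) n * rGamma (a + 1)
        = pochhammer (a + 1) k * rGamma (\<mu> + of_nat k + 1)"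
      by (rule pochhammer_rGamma_swap) (simp add: a_def)
    then show ?thesis
      by (simp add: c_def field_simps)
  qed
  have "summable (\<lambda>k. 4 powr a * (pochhammer (- a) k * pochhammer (a + 1) k
      * rGamma (1 + \<mu> + of_nat k) / fact k * of_real u ^ k))"
    using summable_mult[OF T_conv, of "rGamma (a + 1)"] unfolding termwise .
  then have H_conv: "summable (\<lambda>k. pochhammer (- a) k * pochhammer (a + 1) k
      * rGamma (1 + \<mu> + of_nat k) / fact k * of_real u ^ k)"
    by (subst (asm) summable_cmult_iff) simp
  have TH: "rGamma (a + 1) * T = 4 powr a * H"
    using suminf_mult[OF T_conv, of "rGamma (a + 1)"] suminf_mult[OF H_conv, of "4 powr a"]
    unfolding termwise T_def H_def hyp2f1_reg_def by simp
  have powers: "of_real ((1 - x) / (1 + x)) powr (\<mu> / 2) *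
      (2 powr a * of_real (1 - x\<^sup>2) powr (\<mu> / 2)) * 2 ^ n = 4 powr a * of_real u powr \<mu>"
  proof -
    define L U V where "L = complex_of_real (ln 2)" and "U = complex_of_real (ln u)"
      and "V = complex_of_real (ln (1 - u))"
    have L4: "ln (4 :: real) = 2 * ln 2"
      using ln_realpow[of 2 2] by simp
    have "(1 - x) / (1 + x) = u / (1 - u)"
      using assms by (simp add: u_def field_simps)
    then have q: "of_real ((1 - x) / (1 + x)) powr (\<mu> / 2) = exp (\<mu> / 2 * (U - V))"
      using u by (simp add: powr_of_real_exp ln_div U_def V_def del: of_real_divide)
    have pos: "0 < 1 - x\<^sup>2"
      using assms by (auto simp: abs_square_less_1)
    have p: "of_real (1 - x\<^sup>2) powr (\<mu> / 2) = exp (\<mu> / 2 * (2 * L + U + V))"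
      unfolding powr_of_real_exp[OF pos] ln_one_minus_square[OF assms] L4
        u_def[symmetric] L_def U_def V_def by simp
    have two: "2 powr a = exp (a * L)"
      using powr_of_real_exp[of 2 a] by (simp add: L_def)
    have four: "4 powr a = exp (a * (2 * L))"
      using powr_of_real_exp[of 4 a] by (simp add: L_def L4)
    have "exp L = 2"
      unfolding L_def exp_of_real by simp
    then have twon: "2 ^ n = exp (of_nat n * L)"
      by (simp add: exp_of_nat_mult)
    have upow: "of_real u powr \<mu> = exp (\<mu> * U)"
      using u by (simp add: powr_of_real_exp U_def)
    show ?thesis
      unfolding q p two four twon upow exp_add[symmetric]
      by (rule arg_cong[where f = exp]) (simp add: a_def field_simps)
  qed
  have x2: "1 - x\<^sup>2 \<noteq> 0"
    using assms by (auto simp: power2_eq_1_iff)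
  then have nz: "2 powr a * complex_of_real (1 - x\<^sup>2) powr (\<mu> / 2) \<noteq> 0"
    by (simp del: of_real_diff)
  have lhs: "ferrersP (of_nat n + \<mu>) (- \<mu>) x
      = of_real ((1 - x) / (1 + x)) powr (\<mu> / 2) * H"
    by (simp add: ferrersP_def H_def u_def a_def add_ac)
  have "(- 1) ^ n * rGamma (a + 1) * nth_vector_derivative n (\<lambda>t. of_real (1 - t\<^sup>2) powr a) x
      = ((- 1) ^ n * (- 1 / 2) ^ n) * of_real u powr \<mu> * (rGamma (a + 1) * T)"
    unfolding nth by (simp only: mult_ac)
  also have "(- 1) ^ n * (- 1 / 2) ^ n = (1 / 2 ^ n :: complex)"
    by (simp add: power_one_over flip: power_mult_distrib)
  also have "1 / 2 ^ n * of_real u powr \<mu> * (rGamma (a + 1) * T)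
      = (4 powr a * of_real u powr \<mu>) * H / 2 ^ n"
    by (simp add: TH)
  also have "\<dots> = of_real ((1 - x) / (1 + x)) powr (\<mu> / 2) * H
      * (2 powr a * of_real (1 - x\<^sup>2) powr (\<mu> / 2))"
    by (simp flip: powers)
  finally show ?thesis
    using nz unfolding lhs a_def[symmetric] by (simp add: field_simps del: of_real_diff)
qed

end
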